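(* For $n\geq 2$, $a_n(321;213) = 2^{n-2}$.
   Context: $\mathcal{S}_n$ is the set of permutations of $[n]=\{1,\dots,n\}$, written in one-line notation $\pi=\pi_1\pi_2\cdots\pi_n$ with $\pi_i=\pi(i)$. A permutation is cyclic if it consists of exactly one $n$-cycle. For a cyclic $\pi$, its standard cycle notation is $C(\pi)=(c_1,c_2,\dots,c_n)$ with $c_1=1$ and $c_i=\pi_{c_{i-1}}$ for $2\le i\le n$. A sequence of distinct integers $w_1\cdots w_m$ contains a pattern $\sigma\in\mathcal{S}_k$ if there are indices $i_1<\dots<i_k$ with $w_{i_1}\cdots w_{i_k}$ in the same relative order as $\sigma_1\cdots\sigma_k$; otherwise it avoids $\sigma$. For $\sigma,\tau\in\mathcal{S}_3$, $\mathcal{A}_n(\sigma;\tau)$ is the set of cyclic permutations $\pi\in\mathcal{S}_n$ whose one-line notation avoids $\sigma$ and whose cycle notation $C(\pi)$ (as the sequence $c_1c_2\cdots c_n$) avoids $\tau$; $a_n(\sigma;\tau)=|\mathcal{A}_n(\sigma;\tau)|$. *)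

theory Defs
  imports "HOL-Combinatorics.Combinatorics"
begin

text \<open>
  A permutation of \<open>[n]\<close> is a function \<open>p\<close> with \<open>p permutes {1..n}\<close>; such a function is the identity
  outside \<open>{1..n}\<close>, so distinct permutations are distinct functions and counting them is safe.
  Words and patterns are lists, whose positions are numbered from 0.
\<close>

definition one_line :: "nat \<Rightarrow> (nat \<Rightarrow> nat) \<Rightarrow> nat list" where
  "one_line n p = map p [1..<Suc n]"

text \<open>
  The entry at list position \<open>i\<close> is \<open>c\<^sub>i\<^sub>+\<^sub>1\<close>, the \<open>i\<close>-fold iterate of \<open>p\<close> at 1.  It represents the
  cycle notation of \<open>p\<close> only when \<open>p\<close> is cyclic on \<open>{1..n}\<close>.
\<close>

definition cycle_notation :: "nat \<Rightarrow> (nat \<Rightarrow> nat) \<Rightarrow> nat list" where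
  "cycle_notation n p = map (\<lambda>i. (p ^^ i) 1) [0..<n]"

lemma cycle_notation_nth_0: "0 < n \<Longrightarrow> cycle_notation n p ! 0 = 1"
  by (simp add: cycle_notation_def)

lemma cycle_notation_nth_Suc:
  "Suc i < n \<Longrightarrow> cycle_notation n p ! Suc i = p (cycle_notation n p ! i)"
  by (simp add: cycle_notation_def)

definition contains_pattern :: "nat list \<Rightarrow> nat list \<Rightarrow> bool" where
  "contains_pattern w s \<longleftrightarrow>
    (\<exists>f. strict_mono_on {..<length s} f \<and> f ` {..<length s} \<subseteq> {..<length w} \<and>
      (\<forall>a<length s. \<forall>b<length s. w ! f a < w ! f b \<longleftrightarrow> s ! a < s ! b))"

abbreviation avoids_pattern :: "nat list \<Rightarrow> nat list \<Rightarrow> bool" where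
  "avoids_pattern w s \<equiv> \<not> contains_pattern w s"

definition cyclic_avoiders :: "nat \<Rightarrow> nat list \<Rightarrow> nat list \<Rightarrow> (nat \<Rightarrow> nat) set" where
  "cyclic_avoiders n s t =
    {p. p permutes {1..n} \<and> cyclic_on p {1..n} \<and>
        avoids_pattern (one_line n p) s \<and> avoids_pattern (cycle_notation n p) t}"

definition num_cyclic_avoiders :: "nat \<Rightarrow> nat list \<Rightarrow> nat list \<Rightarrow> nat" where
  "num_cyclic_avoiders n s t = card (cyclic_avoiders n s t)"

end

theory Submission
  imports Defs
begin

text \<open>
  The permutations in question are exactly those whose cycle notation, which begins with 1, first
  increases up to \<open>n\<close> and then decreases; such a word is determined by the set of entries strictly
  between 1 and \<open>n\<close>, an arbitrary subset of \<open>{2..<n}\<close>.  If \<open>C(p)\<close> is of this form, then \<open>p\<close> increases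
  on the entries before \<open>n\<close> and on the remaining ones, hence avoids 321.  Conversely, suppose that
  \<open>C(p)\<close> has consecutive entries \<open>a > b < c\<close>, and let \<open>d\<close> be its first entry that is at least \<open>b\<close>, with
  predecessor \<open>x < b\<close>.  Then either \<open>d b c\<close> is a 213 in \<open>C(p)\<close>, or \<open>p\<close> takes the values \<open>d > c > b\<close> at
  the positions \<open>x < b < a\<close>.
\<close>

section \<open>Patterns of length three\<close>

text \<open>The order condition ranges over position-letter pairs, so that for a concrete pattern
  all nine comparisons simplify at once to strict inequalities.\<close>

lemma contains_pattern3:
  "contains_pattern w [x, y, z] \<longleftrightarrow>
    (\<exists>i j k. i < j \<and> j < k \<and> k < length w \<and>
      (\<forall>(a, s) \<in> {(i, x), (j, y), (k, z)}. \<forall>(b, t) \<in> {(i, x), (j, y), (k, z)}.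
        w ! a < w ! b \<longleftrightarrow> s < t))" (is "?L \<longleftrightarrow> ?R")
proof
  assume ?L
  then obtain f where f: "strict_mono_on {..<3} f" "f ` {..<3} \<subseteq> {..<length w}"
    "\<forall>a<3. \<forall>b<3. w ! f a < w ! f b \<longleftrightarrow> [x, y, z] ! a < [x, y, z] ! b"
    unfolding contains_pattern_def by (auto simp: numeral_3_eq_3)
  have "f 0 < f 1" "f 1 < f 2" "f 2 < length w"
    using f(1,2) by (auto simp: strict_mono_on_def image_subset_iff)
  moreover have "w ! f a < w ! f b \<longleftrightarrow> [x, y, z] ! a < [x, y, z] ! b"
    if "a \<in> {0, 1, 2}" "b \<in> {0, 1, 2}" for a b
    using f(3) that by auto
  ultimately show ?R
    by (intro exI[of _ "f 0"] exI[of _ "f 1"] exI[of _ "f 2"]) simp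
next
  assume ?R
  then obtain i j k where ijk: "i < j" "j < k" "k < length w" and
    *: "\<forall>(a, s) \<in> {(i, x), (j, y), (k, z)}. \<forall>(b, t) \<in> {(i, x), (j, y), (k, z)}.
          w ! a < w ! b \<longleftrightarrow> s < t"
    by blast
  have "strict_mono_on {..<length [x, y, z]} ((!) [i, j, k])"
    using ijk by (auto simp: strict_mono_on_def less_Suc_eq numeral_3_eq_3)
  moreover have "(!) [i, j, k] ` {..<length [x, y, z]} \<subseteq> {..<length w}"
    using ijk by (auto simp: less_Suc_eq numeral_3_eq_3)
  moreover have "\<forall>a<length [x, y, z]. \<forall>b<length [x, y, z].
      w ! ([i, j, k] ! a) < w ! ([i, j, k] ! b) \<longleftrightarrow> [x, y, z] ! a < [x, y, z] ! b"
    using * by (auto simp: less_Suc_eq numeral_3_eq_3)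
  ultimately show ?L
    unfolding contains_pattern_def by blast
qed

lemma contains_213_iff:
  "contains_pattern w [2, 1, 3] \<longleftrightarrow>
    (\<exists>i j k. i < j \<and> j < k \<and> k < length w \<and> w ! j < w ! i \<and> w ! i < w ! k)"
  unfolding contains_pattern3 by (intro ex_cong1 conj_cong refl) auto

lemma contains_321_iff:
  "contains_pattern w [3, 2, 1] \<longleftrightarrow>
    (\<exists>i j k. i < j \<and> j < k \<and> k < length w \<and> w ! k < w ! j \<and> w ! j < w ! i)"
  unfolding contains_pattern3 by (intro ex_cong1 conj_cong refl) auto

text \<open>Position \<open>i\<close> of the list holds \<open>p (Suc i)\<close>, so list positions
  and arguments of \<open>p\<close> differ by an order-preserving shift of one.\<close>

lemma one_line_contains_321_iff:
  "contains_pattern (one_line n p) [3, 2, 1] \<longleftrightarrow>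
    (\<exists>x y z. 1 \<le> x \<and> x < y \<and> y < z \<and> z \<le> n \<and> p z < p y \<and> p y < p x)" (is "?L \<longleftrightarrow> ?R")
proof
  assume ?L
  then obtain i j k where "i < j" "j < k" "k < n" "p (Suc k) < p (Suc j)" "p (Suc j) < p (Suc i)"
    unfolding contains_321_iff one_line_def by (auto simp del: upt_Suc)
  then show ?R
    by (intro exI[of _ "Suc i"] exI[of _ "Suc j"] exI[of _ "Suc k"]) auto
next
  assume ?R
  then obtain x y z where "1 \<le> x" "x < y" "y < z" "z \<le> n" "p z < p y" "p y < p x"
    by blast
  then show ?L
    unfolding contains_321_iff one_line_def
    by (intro exI[of _ "x - 1"] exI[of _ "y - 1"] exI[of _ "z - 1"]) (auto simp del: upt_Suc)
qed

section \<open>Cyclic permutations and their cycle notation\<close>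

lemma length_cycle_notation [simp]: "length (cycle_notation n p) = n"
  by (simp add: cycle_notation_def)

lemma nth_cycle_notation: "i < n \<Longrightarrow> cycle_notation n p ! i = (p ^^ i) 1"
  by (simp add: cycle_notation_def)

text \<open>The iterates of \<open>p\<close> at 1 are distinct until the first return to 1 and fill
  the orbit, so the return time is the size \<open>n\<close> of the orbit.\<close>

lemma cyclic_orbit_of_1:
  assumes "cyclic_on p {1..n}" "n \<ge> 1"
  shows "bij_betw (\<lambda>i. (p ^^ i) 1) {0..<n} {1..n}" "(p ^^ n) 1 = 1"
proof -
  have orb: "orbit p 1 = {1..n}"
    using assms by (intro orbit_cyclic_eq3) auto
  then have self: "1 \<in> orbit p 1"
    using assms by auto
  \<comment> \<open>\<open>?d\<close> is the least positive number of steps from 1 back to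
    1.\<close>
  let ?d = "funpow_dist1 p 1 1"
  have img: "(\<lambda>i. (p ^^ i) 1) ` {0..<?d} = {1..n}"
    using orbit_conv_funpow_dist1[OF self] orb by simp
  moreover have inj: "inj_on (\<lambda>i. (p ^^ i) 1) {0..<?d}"
    using inj_on_funpow_dist1[OF self] .
  ultimately have "?d = n"
    using card_image[OF inj] by simp
  with img inj show "bij_betw (\<lambda>i. (p ^^ i) 1) {0..<n} {1..n}"
    by (metis bij_betw_def)
  show "(p ^^ n) 1 = 1"
    using funpow_dist1_prop[OF self] \<open>?d = n\<close> by metis
qed

lemma distinct_cycle_notation:
  assumes "cyclic_on p {1..n}" "n \<ge> 1"
  shows "distinct (cycle_notation n p)" "set (cycle_notation n p) = {1..n}"
  using cyclic_orbit_of_1(1)[OF assms]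
  by (auto simp: cycle_notation_def distinct_map bij_betw_def)

text \<open>Each entry is sent to the next one and the last back to 1, which fixes \<open>p\<close>
  on \<open>{1..n}\<close>; elsewhere \<open>p\<close> is the identity.\<close>

lemma inj_on_cycle_notation:
  assumes "n \<ge> 1"
  shows "inj_on (cycle_notation n) {p. p permutes {1..n} \<and> cyclic_on p {1..n}}"
proof (intro inj_onI ext)
  fix p q x
  assume p: "p \<in> {p. p permutes {1..n} \<and> cyclic_on p {1..n}}"
    and q: "q \<in> {p. p permutes {1..n} \<and> cyclic_on p {1..n}}"
    and eq: "cycle_notation n p = cycle_notation n q"
  \<comment> \<open>The bound includes \<open>n\<close>, since the image of the last entry is the
    \<open>n\<close>-th iterate.\<close>
  have eqi: "(p ^^ i) 1 = (q ^^ i) 1" if "i \<le> n" for i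
  proof (cases "i = n")
    case True
    then show ?thesis
      using cyclic_orbit_of_1(2)[OF _ assms] p q by simp
  next
    case False
    then show ?thesis
      using eq that by (metis le_neq_implies_less nth_cycle_notation)
  qed
  show "p x = q x"
  proof (cases "x \<in> {1..n}")
    case True
    then have "x \<in> (\<lambda>i. (p ^^ i) 1) ` {0..<n}"
      using cyclic_orbit_of_1(1)[of p n] p assms by (simp add: bij_betw_def)
    then obtain i where i: "i < n" "x = (p ^^ i) 1"
      by auto
    have "p x = (p ^^ Suc i) 1"
      using i by simp
    also have "\<dots> = (q ^^ Suc i) 1"
      using i by (intro eqi) simp
    also have "\<dots> = q x"
      using i eqi[of i] by simp
    finally show ?thesis .
  next
    case False
    then show ?thesis
      using p q permutes_not_in[of _ "{1..n}" x] by (metis mem_Collect_eq)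
  qed
qed

text \<open>This supplies the permutation behind a given word. The \<open>i\<close>-th power of the
  cycle rotates \<open>xs\<close> by \<open>i\<close> places, so it sends the leading 1 to
  \<open>xs ! i\<close>.\<close>

lemma cycle_of_list_cyclic:
  assumes "distinct xs" "set xs = {1..n}" "xs ! 0 = 1" "n \<ge> 1"
  shows "cycle_of_list xs permutes {1..n}" "cyclic_on (cycle_of_list xs) {1..n}"
    "cycle_notation n (cycle_of_list xs) = xs"
proof -
  let ?p = "cycle_of_list xs"
  have len: "length xs = n"
    using assms distinct_card by fastforce
  show "?p permutes {1..n}"
    using cycle_permutes[of xs] assms by simp
  have pow: "(?p ^^ i) 1 = xs ! i" if "i < n" for i
  proof -
    have "(?p ^^ i) (xs ! 0) = rotate i xs ! 0"
      using cyclic_rotation[OF assms(1), of i] len assms(4)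
      by (metis nth_map less_le_trans zero_less_one)
    then show ?thesis
      using that len assms(3) by (simp add: nth_rotate)
  qed
  then show "cycle_notation n ?p = xs"
    using len by (auto intro!: nth_equalityI simp: nth_cycle_notation)
  \<comment> \<open>The \<open>n\<close>-th power of the cycle is the identity, so the first
    \<open>n\<close> iterates already exhaust the orbit.\<close>
  have "orbit ?p 1 = {(?p ^^ m) 1 | m. m < n}"
    using cycle_is_id_root[OF assms(1)] len assms(4) by (intro orbit_altdef_bounded) auto
  also have "\<dots> = {xs ! m | m. m < n}"
    using pow by metis
  also have "\<dots> = {1..n}"
    using assms(2) len by (auto simp: set_conv_nth)
  finally show "cyclic_on ?p {1..n}"
    using assms(4) by (intro cyclic_on_singleI[of 1]) auto
qed

section \<open>Words that increase and then decrease\<close>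

text \<open>Keeping the forced entries 1 and \<open>n\<close> out of \<open>S\<close> leaves
  \<open>S\<close> free to be any subset of \<open>{2..<n}\<close>, which makes the count a power of
  two.\<close>

definition arch :: "nat \<Rightarrow> nat set \<Rightarrow> nat list" where
  "arch n S = sorted_list_of_set (insert 1 S) @ n # rev (sorted_list_of_set ({2..<n} - S))"

lemma distinct_arch:
  assumes "S \<subseteq> {2..<n}" "n \<ge> 2"
  shows "distinct (arch n S)" "set (arch n S) = {1..n}" "arch n S ! 0 = 1"
proof -
  have fin: "finite S"
    using assms finite_subset by blast
  then show "distinct (arch n S)" "set (arch n S) = {1..n}"
    using assms unfolding arch_def by (auto simp del: sorted_list_of_set_insert_remove)
  have "Min (insert 1 S) = 1"
    using assms fin by (intro Min_eqI) auto
  then show "arch n S ! 0 = 1"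
    using fin unfolding arch_def by (subst sorted_list_of_set_nonempty)
      (auto simp del: sorted_list_of_set_insert_remove)
qed

text \<open>The entries before \<open>n\<close>, with 1 removed, give back \<open>S\<close>.\<close>

lemma inj_on_arch:
  assumes "n \<ge> 2"
  shows "inj_on (arch n) (Pow {2..<n})"
proof (intro inj_onI)
  have *: "S = set (takeWhile (\<lambda>x. x \<noteq> n) (arch n S)) - {1}" if "S \<in> Pow {2..<n}" for S
  proof -
    have "finite S"
      using that finite_subset by blast
    then show ?thesis
      using that assms unfolding arch_def by (subst takeWhile_append2)
        (auto simp del: sorted_list_of_set_insert_remove)
  qed
  fix S T
  assume "S \<in> Pow {2..<n}" "T \<in> Pow {2..<n}" "arch n S = arch n T"
  then show "S = T"
    using * by metis
qed

text \<open>The index \<open>m\<close> is the position of the peak \<open>n\<close>, which belongs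
  to both monotone ranges; hence \<open>n\<close> is attached to \<open>us\<close> in
  \<open>up\<close> and to \<open>vs\<close> in \<open>down\<close>.\<close>

lemma arch_nth_mono:
  assumes "S \<subseteq> {2..<n}" "n \<ge> 2"
  obtains m where "m < n"
    "\<And>i j. i < j \<Longrightarrow> j \<le> m \<Longrightarrow> arch n S ! i < arch n S ! j"
    "\<And>i j. m \<le> i \<Longrightarrow> i < j \<Longrightarrow> j < n \<Longrightarrow> arch n S ! j < arch n S ! i"
proof -
  define us where "us = sorted_list_of_set (insert 1 S)"
  define vs where "vs = rev (sorted_list_of_set ({2..<n} - S))"
  have fin: "finite S"
    using assms finite_subset by blast
  have arch: "arch n S = us @ n # vs"
    by (simp add: arch_def us_def vs_def)
  have len: "length (us @ n # vs) = n"
    using distinct_card[OF distinct_arch(1)[OF assms]] distinct_arch(2)[OF assms] arch by simp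
  have up: "sorted_wrt (<) (us @ [n])"
    using assms fin by (auto simp: us_def sorted_wrt_append simp del: sorted_list_of_set_insert_remove)
  have down: "sorted_wrt (>) (n # vs)"
    using assms fin by (auto simp: vs_def sorted_wrt_rev)
  show ?thesis
  proof (rule that[of "length us"])
    show "length us < n"
      using len by simp
    show "arch n S ! i < arch n S ! j" if "i < j" "j \<le> length us" for i j
      using sorted_wrt_nth_less[OF up, of i j] that
      by (auto simp: arch nth_append split: if_splits)
    show "arch n S ! j < arch n S ! i" if "length us \<le> i" "i < j" "j < n" for i j
      using sorted_wrt_nth_less[OF down, of "i - length us" "j - length us"] that len
      by (auto simp: arch nth_append)
  qed
qed

text \<open>Without valleys, a descent is followed only by descents. None occurs before the maximum
  \<open>n\<close>, as it would propagate to the step into \<open>n\<close>; the step out of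
  \<open>n\<close>, if there is one, is a descent, so the word decreases from there on.\<close>

lemma no_valley_imp_arch:
  assumes "distinct xs" "set xs = {1..n}" "xs ! 0 = 1" "n \<ge> 2"
    and no_valley:
      "\<And>i. Suc (Suc i) < length xs \<Longrightarrow> xs ! Suc i < xs ! i \<Longrightarrow> xs ! Suc (Suc i) < xs ! Suc i"
  shows "xs \<in> arch n ` Pow {2..<n}"
proof -
  have "n \<in> set xs"
    using assms by auto
  then obtain us vs where xs: "xs = us @ n # vs"
    by (meson split_list)
  \<comment> \<open>As \<open>n\<close> is at least 2, the leading 1 is not the peak, so it lies in
    \<open>us\<close>.\<close>
  have "us \<noteq> []"
    using assms(3,4) xs by (cases us) auto
  then have one: "1 \<in> set us"
    using assms(3) xs by (cases us) auto
  have le: "xs ! i \<le> n" if "i < length xs" for i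
    using that assms(2) nth_mem by fastforce
  have descents: "xs ! Suc (i + k) < xs ! (i + k)"
    if "xs ! Suc i < xs ! i" "Suc (i + k) < length xs" for i k
    using that(2)
  proof (induction k)
    case 0
    then show ?case
      using that(1) by simp
  next
    case (Suc k)
    then show ?case
      using no_valley[of "i + k"] by simp
  qed
  have peak: "xs ! length us = n"
    by (simp add: xs)
  have up: "xs ! i < xs ! Suc i" if "i < length us" for i
  proof (rule ccontr)
    assume "\<not> xs ! i < xs ! Suc i"
    moreover have "xs ! i \<noteq> xs ! Suc i"
      using assms(1) that xs nth_eq_iff_index_eq[of xs i "Suc i"] by simp
    ultimately have "xs ! Suc i < xs ! i"
      by simp
    from descents[OF this, of "length us - 1 - i"] that
    have "xs ! Suc (length us - 1) < xs ! (length us - 1)"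
      by (simp add: xs)
    then have "n < xs ! (length us - 1)"
      using that peak by (cases us) auto
    moreover have "xs ! (length us - 1) \<le> n"
      by (rule le) (simp add: xs)
    ultimately show False
      by simp
  qed
  have down: "xs ! Suc i < xs ! i" if "length us \<le> i" "Suc i < length xs" for i
  proof -
    have s: "Suc (length us) < length xs"
      using that by simp
    have "xs ! Suc (length us) \<noteq> xs ! length us"
      using assms(1) s nth_eq_iff_index_eq[of xs "Suc (length us)" "length us"] by simp
    then have "xs ! Suc (length us) < xs ! length us"
      using le[OF s] peak by simp
    from descents[OF this, of "i - length us"] that show ?thesis
      by simp
  qed
  have "us ! i < us ! Suc i" if "Suc i < length us" for i
    using up[of i] that by (simp add: xs nth_append)
  then have us_sorted: "sorted_wrt (<) us"
    by (simp add: sorted_wrt_iff_nth_Suc_transp)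
  have "transp ((>) :: nat \<Rightarrow> nat \<Rightarrow> bool)"
    by (auto intro: transpI)
  moreover have "vs ! Suc i < vs ! i" if "Suc i < length vs" for i
    using down[of "Suc (length us + i)"] that by (simp add: xs nth_append)
  ultimately have "sorted_wrt (>) vs"
    by (simp add: sorted_wrt_iff_nth_Suc_transp)
  then have vs_sorted: "sorted_wrt (<) (rev vs)"
    by (simp add: sorted_wrt_rev)
  define S where "S = set us - {1}"
  have sub: "S \<subseteq> {2..<n}"
  proof
    fix x assume "x \<in> S"
    then have "x \<in> set us" "x \<noteq> 1" "x \<in> {1..n}" "x \<noteq> n"
      using assms(1,2) by (auto simp: S_def xs)
    then show "x \<in> {2..<n}"
      by auto
  qed
  \<comment> \<open>A strictly increasing list is determined by its set of entries; the same applies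
    to \<open>rev vs\<close> below.\<close>
  have "us = sorted_list_of_set (insert 1 S)"
    using one us_sorted
    by (intro strict_sorted_equal) (auto simp: S_def simp del: sorted_list_of_set_insert_remove)
  moreover have "set vs = {2..<n} - S"
  proof -
    have "{1..n} = insert n (set us \<union> set vs)" "n \<notin> set vs" "set us \<inter> set vs = {}"
      using assms(1,2) by (auto simp: xs)
    then have "set vs = {1..n} - insert n (set us)"
      by blast
    moreover have "{2..<n} - S = {1..n} - insert n (set us)"
      using one by (auto simp: S_def le_less Suc_le_eq)
    ultimately show ?thesis
      by simp
  qed
  then have "rev vs = sorted_list_of_set ({2..<n} - S)"
    using vs_sorted by (intro strict_sorted_equal) auto
  then have "vs = rev (sorted_list_of_set ({2..<n} - S))"
    by (simp add: rev_swap)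
  ultimately have "xs = arch n S"
    by (simp add: xs arch_def)
  with sub show ?thesis
    by blast
qed

section \<open>The avoiders\<close>

text \<open>In a 213 the drop from the first to the second entry places the second beyond the peak,
  where only smaller entries follow.\<close>

lemma arch_avoids_213:
  assumes "S \<subseteq> {2..<n}" "n \<ge> 2"
  shows "avoids_pattern (arch n S) [2, 1, 3]"
proof
  assume "contains_pattern (arch n S) [2, 1, 3]"
  moreover have "length (arch n S) = n"
    using distinct_card[OF distinct_arch(1)[OF assms]] distinct_arch(2)[OF assms] by simp
  ultimately obtain i j k where ijk: "i < j" "j < k" "k < n"
    "arch n S ! j < arch n S ! i" "arch n S ! i < arch n S ! k"
    unfolding contains_213_iff by auto
  obtain m where
    up: "\<And>i j. i < j \<Longrightarrow> j \<le> m \<Longrightarrow> arch n S ! i < arch n S ! j" and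
    down: "\<And>i j. m \<le> i \<Longrightarrow> i < j \<Longrightarrow> j < n \<Longrightarrow> arch n S ! j < arch n S ! i"
    using arch_nth_mono[OF assms] by metis
  have "m < j"
    using up[of i j] ijk by force
  then show False
    using down[of j k] ijk by simp
qed

text \<open>Values are ordered like positions before the peak and oppositely from the peak on.
  Passing to the next entry respects this on either part, so \<open>p\<close> increases on
  each.\<close>

lemma arch_cycle_avoids_321:
  assumes p: "cyclic_on p {1..n}" and S: "S \<subseteq> {2..<n}" and n: "n \<ge> 2"
    and arch: "cycle_notation n p = arch n S"
  shows "avoids_pattern (one_line n p) [3, 2, 1]"
proof
  define c where "c i = (p ^^ i) 1" for i
  have p_c: "p (c i) = c (Suc i)" for i
    by (simp add: c_def)
  have bij: "bij_betw c {0..<n} {1..n}" and c_n: "c n = 1"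
    using cyclic_orbit_of_1[OF p] n by (auto simp: c_def[abs_def])
  have arch_c: "arch n S ! i = c i" if "i < n" for i
    using arch nth_cycle_notation[OF that, of p] by (simp add: c_def)
  obtain m where m: "m < n"
    "\<And>i j. i < j \<Longrightarrow> j \<le> m \<Longrightarrow> arch n S ! i < arch n S ! j"
    "\<And>i j. m \<le> i \<Longrightarrow> i < j \<Longrightarrow> j < n \<Longrightarrow> arch n S ! j < arch n S ! i"
    using arch_nth_mono[OF S n] by metis
  have up: "c i < c j" if "i < j" "j \<le> m" for i j
    using m(1) m(2)[of i j] that by (simp add: arch_c)
  have down: "c j < c i" if "m \<le> i" "i < j" "j < n" for i j
    using m(3)[of i j] that by (simp add: arch_c)
  have c_gt_1: "1 < c i" if "0 < i" "i < n" for i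
  proof -
    have "c i \<noteq> c 0"
      using bij that by (auto simp: bij_betw_def dest: inj_onD)
    moreover have "c i \<in> {1..n}"
      using bij that by (auto simp: bij_betw_def)
    ultimately show ?thesis
      by (auto simp: c_def)
  qed
  have mono: "p (c i) < p (c j)" if "c i < c j" "i < n" "j < n" "i < m \<longleftrightarrow> j < m" for i j
  proof (cases "i < m")
    case True
    then have "i < j"
      using that up[of j i] by (cases i j rule: linorder_cases) auto
    then show ?thesis
      using True that up[of "Suc i" "Suc j"] by (simp add: p_c)
  next
    case False
    then have "j < i"
      using that down[of i j] by (cases i j rule: linorder_cases) auto
    show ?thesis
    \<comment> \<open>The last entry is the smallest of its part and is sent back to 1, below the
      images of all others.\<close>
    proof (cases "Suc i = n")
      case True
      then show ?thesis
        using c_n c_gt_1[of "Suc j"] \<open>j < i\<close> by (simp add: p_c)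
    next
      case ne: False
      then show ?thesis
        using False that \<open>j < i\<close> down[of "Suc j" "Suc i"] by (simp add: p_c)
    qed
  qed
  assume "contains_pattern (one_line n p) [3, 2, 1]"
  then obtain x y z where xyz: "1 \<le> x" "x < y" "y < z" "z \<le> n" "p z < p y" "p y < p x"
    unfolding one_line_contains_321_iff by blast
  then have "x \<in> c ` {0..<n}" "y \<in> c ` {0..<n}" "z \<in> c ` {0..<n}"
    using bij by (auto simp: bij_betw_def)
  then obtain i j k where "x = c i" "y = c j" "z = c k" "i < n" "j < n" "k < n"
    by auto
  \<comment> \<open>By pigeonhole two of the three entries lie in the same part, and an inversion
    between them contradicts \<open>mono\<close>.\<close>
  then show False
    using mono[of i j] mono[of i k] mono[of j k] xyz by force
qed

lemma avoider_no_valley: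
  assumes p: "cyclic_on p {1..n}"
    and av321: "avoids_pattern (one_line n p) [3, 2, 1]"
    and av213: "avoids_pattern (cycle_notation n p) [2, 1, 3]"
    and i: "Suc (Suc i) < n"
    and descent: "cycle_notation n p ! Suc i < cycle_notation n p ! i"
  shows "cycle_notation n p ! Suc (Suc i) < cycle_notation n p ! Suc i"
proof (rule ccontr)
  define c where "c i = (p ^^ i) 1" for i
  have cn: "cycle_notation n p ! i = c i" if "i < n" for i
    using that by (simp add: nth_cycle_notation c_def)
  have p_c: "p (c i) = c (Suc i)" for i
    by (simp add: c_def)
  have bij: "bij_betw c {0..<n} {1..n}"
    using cyclic_orbit_of_1(1)[OF p] i by (simp add: c_def[abs_def])
  have neq: "c a \<noteq> c b" if "a < n" "b < n" "a \<noteq> b" for a b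
    using bij that by (auto simp: bij_betw_def dest: inj_onD)
  have range: "1 \<le> c a \<and> c a \<le> n" if "a < n" for a
    using bij that by (auto simp: bij_betw_def)
  assume "\<not> cycle_notation n p ! Suc (Suc i) < cycle_notation n p ! Suc i"
  then have bc: "c (Suc i) < c (Suc (Suc i))"
    using i neq[of "Suc i" "Suc (Suc i)"] by (simp add: cn)
  have ba: "c (Suc i) < c i"
    using descent i by (simp add: cn)
  \<comment> \<open>\<open>c j\<close> is the first entry that reaches the valley's bottom
    \<open>c (Suc i)\<close>; since \<open>c i\<close> does so too, \<open>j\<close> comes before
    the bottom.\<close>
  define j where "j = (LEAST j. c (Suc i) \<le> c j)"
  have j: "c (Suc i) \<le> c j" "j \<le> i"
    unfolding j_def using ba by (auto intro: LeastI[of _ i] Least_le)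
  then have bd: "c (Suc i) < c j"
    using i neq[of "Suc i" j] by (simp add: le_less)
  \<comment> \<open>The bottom exceeds the initial entry 1, so \<open>c j\<close> has a predecessor
    \<open>c h\<close>, which is below the bottom by minimality of \<open>j\<close>.\<close>
  have "c (Suc i) > c 0"
    using i neq[of "Suc i" 0] range[of "Suc i"] by (simp add: c_def)
  then have "j \<noteq> 0"
    using bd j(1) not_less_Least[of 0 "\<lambda>j. c (Suc i) \<le> c j"] j_def by (metis leD)
  then obtain h where h: "j = Suc h"
    using not0_implies_Suc by blast
  then have xb: "c h < c (Suc i)"
    using not_less_Least[of h "\<lambda>j. c (Suc i) \<le> c j"] j_def by simp
  show False
  proof (cases "c j < c (Suc (Suc i))")
    case True
    then have "contains_pattern (cycle_notation n p) [2, 1, 3]"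
      unfolding contains_213_iff using i j bd
      by (intro exI[of _ j] exI[of _ "Suc i"] exI[of _ "Suc (Suc i)"]) (simp add: cn)
    with av213 show False ..
  next
    case False
    then have "c (Suc (Suc i)) < c j"
      using i j neq[of "Suc (Suc i)" j] by simp
    \<comment> \<open>The arguments \<open>c h\<close>, \<open>c (Suc i)\<close>, \<open>c i\<close>
      increase, while their images, the next entries of the cycle, decrease.\<close>
    then have "contains_pattern (one_line n p) [3, 2, 1]"
      unfolding one_line_contains_321_iff using i j h xb ba bc range[of h] range[of i]
      by (intro exI[of _ "c h"] exI[of _ "c (Suc i)"] exI[of _ "c i"]) (simp add: p_c)
    with av321 show False ..
  qed
qed

text \<open>Avoiders have no valleys, hence give arches; conversely the cycle read off an arch is
  itself an avoider.\<close>

lemma cycle_notation_image_avoiders: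
  assumes "n \<ge> 2"
  shows "cycle_notation n ` cyclic_avoiders n [3, 2, 1] [2, 1, 3] = arch n ` Pow {2..<n}"
proof (intro equalityI subsetI)
  fix xs
  assume "xs \<in> cycle_notation n ` cyclic_avoiders n [3, 2, 1] [2, 1, 3]"
  then obtain p where p: "cyclic_on p {1..n}" "avoids_pattern (one_line n p) [3, 2, 1]"
    "avoids_pattern (cycle_notation n p) [2, 1, 3]" and xs: "xs = cycle_notation n p"
    by (auto simp: cyclic_avoiders_def)
  show "xs \<in> arch n ` Pow {2..<n}"
    unfolding xs
  proof (rule no_valley_imp_arch)
    show "distinct (cycle_notation n p)" "set (cycle_notation n p) = {1..n}"
      using distinct_cycle_notation[OF p(1)] assms by auto
    show "cycle_notation n p ! 0 = 1"
      using assms by (simp add: cycle_notation_nth_0)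
  qed (use assms avoider_no_valley[OF p] in auto)
next
  fix xs
  assume "xs \<in> arch n ` Pow {2..<n}"
  then obtain S where S: "S \<subseteq> {2..<n}" and xs: "xs = arch n S"
    by auto
  have "n \<ge> 1"
    using assms by simp
  note cyc = cycle_of_list_cyclic[OF distinct_arch[OF S assms] this]
  have "cycle_of_list (arch n S) \<in> cyclic_avoiders n [3, 2, 1] [2, 1, 3]"
    using cyc arch_avoids_213[OF S assms] arch_cycle_avoids_321[OF cyc(2) S assms cyc(3)]
    by (simp add: cyclic_avoiders_def)
  then show "xs \<in> cycle_notation n ` cyclic_avoiders n [3, 2, 1] [2, 1, 3]"
    using cyc(3) xs by (metis imageI)
qed

theorem theorem3p24:
  fixes n :: nat
  assumes "n \<ge> 2"
  shows "num_cyclic_avoiders n [3, 2, 1] [2, 1, 3] = 2 ^ (n - 2)"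
proof -
  \<comment> \<open>The count passes through two injections with the same image, from permutations
    to words and from subsets to words.\<close>
  have "inj_on (cycle_notation n) (cyclic_avoiders n [3, 2, 1] [2, 1, 3])"
    using assms by (intro inj_on_subset[OF inj_on_cycle_notation]) (auto simp: cyclic_avoiders_def)
  then have "num_cyclic_avoiders n [3, 2, 1] [2, 1, 3] = card (arch n ` Pow {2..<n})"
    unfolding num_cyclic_avoiders_def
    by (simp add: card_image flip: cycle_notation_image_avoiders[OF assms])
  also have "\<dots> = card (Pow {2..<n})"
    using inj_on_arch[OF assms] by (rule card_image)
  also have "\<dots> = 2 ^ (n - 2)"
    by (simp add: card_Pow)
  finally show ?thesis .
qed

end
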